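(* Let $(\mathcal{H},\Lambda)$ be a Hopf Galois order setting and let $F$ be an $\mathcal{H}$-Galois $\Lambda$-order. Let $F_-=\{X\in F\mid\hat X(1_\Lambda)=0\}$. Then $F_-$ is a left $\Lambda$-submodule of $F$ and $$F=\Lambda\oplus F_-.$$
   Context: Let $\Bbbk$ be an arbitrary field; all algebras are over $\Bbbk$ and $\otimes=\otimes_{\Bbbk}$. A Hopf Galois order setting (or setting) is a pair $(\mathcal{H},\Lambda)$ where $\mathcal{H}$ is a left coideal subalgebra (a subalgebra with $\Delta(\mathcal{H})\subset\tilde{\mathcal{H}}\otimes\mathcal{H}$) of a Hopf algebra $\tilde{\mathcal{H}}$ (which is part of the data) with comultiplication $\Delta(x)=x_{(1)}\otimes x_{(2)}$, counit $\varepsilon$ and invertible antipode $S$, and $\Lambda$ is a left $\tilde{\mathcal{H}}$-module algebra (action denoted $x\triangleright a$) such that (i) $\Lambda$ is a noetherian (commutative) integral domain; (ii) the action of $\tilde{\mathcal{H}}$ on $\Lambda$ extends to an action on the field of fractions $L=\mathrm{Frac}(\Lambda)$ (also denoted $\triangleright$); (iii) $\Lambda$ is faithful as a left module over the smash product $\Lambda\#\mathcal{H}$. The smash product $A\#\mathcal{H}$ (for $A=\Lambda$ or $L$) is the algebra containing $A$ and $\mathcal{H}$ as subalgebras such that $A\otimes\mathcal{H}\to A\#\mathcal{H}$, $a\otimes x\mapsto ax$, is a vector space isomorphism and $xa=(x_{(1)}\triangleright a)x_{(2)}$ for $x\in\mathcal{H}$, $a\in A$. For $X\in L\#\tilde{\mathcal{H}}$,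 $\hat X$ denotes the corresponding linear endomorphism of $L$, determined by $\hat f(g)=fg$ for $f,g\in L$ and $\hat x(f)=x\triangleright f$ for $x\in\tilde{\mathcal{H}}$. An $\mathcal{H}$-Galois $\Lambda$-order is a subalgebra $F\subset L\#\mathcal{H}$ such that $\Lambda\subset F$, $LF=L\#\mathcal{H}$, and $\hat X(\Lambda)\subset\Lambda$ for all $X\in F$. *)

theory Defs
  imports "HOL-Library.Poly_Mapping" "HOL-Computational_Algebra.Polynomial_Factorial"
begin

definition lin_ext :: "('k::zero \<Rightarrow> 'v \<Rightarrow> 'v::comm_monoid_add) \<Rightarrow> ('i \<Rightarrow> 'v) \<Rightarrow> ('i \<Rightarrow>\<^sub>0 'k) \<Rightarrow> 'v"
  where "lin_ext s f t = (\<Sum>i\<in>Poly_Mapping.keys t. s (Poly_Mapping.lookup t i) (f i))"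

definition free_scale :: "'k::field \<Rightarrow> ('i \<Rightarrow>\<^sub>0 'k) \<Rightarrow> ('i \<Rightarrow>\<^sub>0 'k)"
  where "free_scale c t = Poly_Mapping.map ((*) c) t"

text \<open>
  Elements of a tensor product are equivalence classes of formal linear combinations of pairs
  (or triples), modulo the subspace spanned by the multilinearity relations. The set
  \<open>slot_relations s p\<close> contains the relations making \<open>p\<close> linear, where \<open>p v\<close> is a tuple with the
  vector \<open>v\<close> in one slot and all other slots fixed.
\<close>

definition slot_relations ::
  "('k::field \<Rightarrow> 'v \<Rightarrow> 'v::ab_group_add) \<Rightarrow> ('v \<Rightarrow> 'i) \<Rightarrow> ('i \<Rightarrow>\<^sub>0 'k) set" where
  "slot_relations s p =
     {Poly_Mapping.single (p (v + v')) 1 - Poly_Mapping.single (p v) 1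
        - Poly_Mapping.single (p v') 1 | v v'. True} \<union>
     {Poly_Mapping.single (p (s c v)) 1 - Poly_Mapping.single (p v) c | c v. True}"

definition tensor_eq ::
  "('k::field \<Rightarrow> 'v \<Rightarrow> 'v::ab_group_add) \<Rightarrow> ('k \<Rightarrow> 'w \<Rightarrow> 'w::ab_group_add) \<Rightarrow>
   (('v \<times> 'w) \<Rightarrow>\<^sub>0 'k) rel" where
  "tensor_eq sV sW = {(t, u). t - u \<in> module.span free_scale
     ((\<Union>w. slot_relations sV (\<lambda>v. (v, w))) \<union>
      (\<Union>v. slot_relations sW (\<lambda>w. (v, w))))}"

definition tensor3_eq ::
  "('k::field \<Rightarrow> 'v \<Rightarrow> 'v::ab_group_add) \<Rightarrow> (('v \<times> 'v \<times> 'v) \<Rightarrow>\<^sub>0 'k) rel" where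
  "tensor3_eq s = {(t, u). t - u \<in> module.span free_scale
     ((\<Union>v w. slot_relations s (\<lambda>u. (u, v, w))) \<union>
      (\<Union>u w. slot_relations s (\<lambda>v. (u, v, w))) \<union>
      (\<Union>u v. slot_relations s (\<lambda>w. (u, v, w))))}"

text \<open>The product \<open>(a \<otimes> b) (c \<otimes> d) = a c \<otimes> b d\<close>, on representatives.\<close>

definition tensor_mult ::
  "(('a::times \<times> 'b::times) \<Rightarrow>\<^sub>0 'k::field) \<Rightarrow> (('a \<times> 'b) \<Rightarrow>\<^sub>0 'k) \<Rightarrow> (('a \<times> 'b) \<Rightarrow>\<^sub>0 'k)" where
  "tensor_mult t u =
     lin_ext free_scale (\<lambda>(a, b). lin_ext free_scale
       (\<lambda>(c, d). Poly_Mapping.single (a * c, b * d) 1) u) t"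

locale k_algebra = vector_space scale
  for scale :: "'k::field \<Rightarrow> 'a::ring_1 \<Rightarrow> 'a" +
  assumes scale_mult_left: "scale c (a * b) = scale c a * b"
    and scale_mult_right: "scale c (a * b) = a * scale c b"

definition algebra_hom ::
  "('k::field \<Rightarrow> 'a::ring_1 \<Rightarrow> 'a) \<Rightarrow> ('k \<Rightarrow> 'b::ring_1 \<Rightarrow> 'b) \<Rightarrow> ('a \<Rightarrow> 'b) \<Rightarrow> bool" where
  "algebra_hom sA sB f \<longleftrightarrow>
     Vector_Spaces.linear sA sB f \<and> f 1 = 1 \<and> (\<forall>a b. f (a * b) = f a * f b)"

definition subalgebra :: "('k::field \<Rightarrow> 'a::ring_1 \<Rightarrow> 'a) \<Rightarrow> 'a set \<Rightarrow> bool" where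
  "subalgebra s B \<longleftrightarrow> module.subspace s B \<and> 1 \<in> B \<and> (\<forall>a\<in>B. \<forall>b\<in>B. a * b \<in> B)"

text \<open>
  The value \<open>\<Delta> x\<close> is an element of the quotient \<open>H \<otimes> H\<close>, that is, an equivalence class;
  \<open>t \<in> \<Delta> x\<close> says that the formal combination \<open>t\<close> represents it. Thus \<open>lin_ext s (\<lambda>(y, z). f y z) t\<close>
  for \<open>t \<in> \<Delta> x\<close> is the Sweedler sum of \<open>f\<close> over the two tensor factors of \<open>\<Delta> x\<close>.
\<close>

locale hopf_algebra = k_algebra sH
  for sH :: "'k::field \<Rightarrow> 'h::ring_1 \<Rightarrow> 'h" +
  fixes \<Delta> :: "'h \<Rightarrow> (('h \<times> 'h) \<Rightarrow>\<^sub>0 'k) set"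
    and \<epsilon> :: "'h \<Rightarrow> 'k"
    and S :: "'h \<Rightarrow> 'h"
  assumes comult_in_tensor: "\<Delta> x \<in> UNIV // tensor_eq sH sH"
    and comult_add: "t \<in> \<Delta> x \<Longrightarrow> u \<in> \<Delta> y \<Longrightarrow> t + u \<in> \<Delta> (x + y)"
    and comult_scale: "t \<in> \<Delta> x \<Longrightarrow> free_scale c t \<in> \<Delta> (sH c x)"
    and comult_one: "Poly_Mapping.single (1, 1) 1 \<in> \<Delta> 1"
    and comult_mult: "t \<in> \<Delta> x \<Longrightarrow> u \<in> \<Delta> y \<Longrightarrow> tensor_mult t u \<in> \<Delta> (x * y)"
    and counit_hom: "algebra_hom sH (*) \<epsilon>"
    and coassoc: "t \<in> \<Delta> x \<Longrightarrow> (\<And>y. \<delta> y \<in> \<Delta> y) \<Longrightarrow>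
      (lin_ext free_scale (\<lambda>(y, z). lin_ext free_scale
         (\<lambda>(y1, y2). Poly_Mapping.single (y1, y2, z) 1) (\<delta> y)) t,
       lin_ext free_scale (\<lambda>(y, z). lin_ext free_scale
         (\<lambda>(z1, z2). Poly_Mapping.single (y, z1, z2) 1) (\<delta> z)) t) \<in> tensor3_eq sH"
    and counit_left: "t \<in> \<Delta> x \<Longrightarrow> lin_ext sH (\<lambda>(y, z). sH (\<epsilon> y) z) t = x"
    and counit_right: "t \<in> \<Delta> x \<Longrightarrow> lin_ext sH (\<lambda>(y, z). sH (\<epsilon> z) y) t = x"
    and antipode_linear: "Vector_Spaces.linear sH sH S"
    and antipode_left: "t \<in> \<Delta> x \<Longrightarrow> lin_ext sH (\<lambda>(y, z). S y * z) t = sH (\<epsilon> x) 1"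
    and antipode_right: "t \<in> \<Delta> x \<Longrightarrow> lin_ext sH (\<lambda>(y, z). y * S z) t = sH (\<epsilon> x) 1"

text \<open>Here \<open>H' \<otimes> B\<close>, for the whole algebra \<open>H'\<close>, is viewed as a subspace of \<open>H' \<otimes> H'\<close>.\<close>

definition left_coideal_subalgebra ::
  "('k::field \<Rightarrow> 'h::ring_1 \<Rightarrow> 'h) \<Rightarrow> ('h \<Rightarrow> (('h \<times> 'h) \<Rightarrow>\<^sub>0 'k) set) \<Rightarrow> 'h set \<Rightarrow> bool" where
  "left_coideal_subalgebra sH \<Delta> B \<longleftrightarrow> subalgebra sH B \<and>
     (\<forall>x\<in>B. \<exists>t\<in>\<Delta> x. Poly_Mapping.keys t \<subseteq> UNIV \<times> B)"

locale module_algebra = hopf_algebra sH \<Delta> \<epsilon> S + A: k_algebra sA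
  for sH :: "'k::field \<Rightarrow> 'h::ring_1 \<Rightarrow> 'h" and \<Delta> \<epsilon> S
    and sA :: "'k \<Rightarrow> 'a::ring_1 \<Rightarrow> 'a" +
  fixes act :: "'h \<Rightarrow> 'a \<Rightarrow> 'a"
  assumes act_linear: "Vector_Spaces.linear sA sA (act x)"
    and act_linear_left: "Vector_Spaces.linear sH sA (\<lambda>x. act x a)"
    and act_one: "act 1 a = a"
    and act_mult: "act (x * y) a = act x (act y a)"
    and act_unit: "act x 1 = sA (\<epsilon> x) 1"
    and act_prod: "t \<in> \<Delta> x \<Longrightarrow> act x (a * b) = lin_ext sA (\<lambda>(y, z). act y a * act z b) t"

text \<open>
  The algebra \<open>'p\<close> is the smash product \<open>A # H\<close>, where \<open>\<iota>A\<close> and \<open>\<iota>H\<close> are the inclusions of the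
  subalgebras \<open>A\<close> and \<open>H\<close>. The assumptions \<open>smash_kernel\<close> and \<open>smash_surj\<close> say that
  \<open>a \<otimes> x \<mapsto> a x\<close> is a well-defined linear bijection from \<open>A \<otimes> H\<close> onto \<open>'p\<close>.
\<close>

locale smash_product = module_algebra sH \<Delta> \<epsilon> S sA act + P: k_algebra sP
  for sH :: "'k::field \<Rightarrow> 'h::ring_1 \<Rightarrow> 'h" and \<Delta> \<epsilon> S
    and sA :: "'k \<Rightarrow> 'a::ring_1 \<Rightarrow> 'a" and act
    and sP :: "'k \<Rightarrow> 'p::ring_1 \<Rightarrow> 'p" +
  fixes \<iota>A :: "'a \<Rightarrow> 'p" and \<iota>H :: "'h \<Rightarrow> 'p"
  assumes incl_A: "algebra_hom sA sP \<iota>A" "inj \<iota>A"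
    and incl_H: "algebra_hom sH sP \<iota>H" "inj \<iota>H"
    and smash_kernel:
      "lin_ext sP (\<lambda>(a, x). \<iota>A a * \<iota>H x) T = lin_ext sP (\<lambda>(a, x). \<iota>A a * \<iota>H x) U \<longleftrightarrow>
       (T, U) \<in> tensor_eq sA sH"
    and smash_surj: "surj (lin_ext sP (\<lambda>(a, x). \<iota>A a * \<iota>H x))"
    and smash_commute:
      "t \<in> \<Delta> x \<Longrightarrow> \<iota>H x * \<iota>A a = lin_ext sP (\<lambda>(y, z). \<iota>A (act y a) * \<iota>H z) t"

text \<open>
  For subspaces \<open>B\<close> of \<open>A\<close> and \<open>C\<close> of \<open>H\<close>, the image of \<open>B \<otimes> C\<close> in \<open>A # H\<close>. As tensoring over a
  field is exact, this is the smash product \<open>B # C\<close> whenever \<open>B\<close> is an \<open>H\<close>-stable subalgebra and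
  \<open>C\<close> a left coideal subalgebra.
\<close>

definition smash_sub ::
  "('k::field \<Rightarrow> 'p::ring_1 \<Rightarrow> 'p) \<Rightarrow> ('a \<Rightarrow> 'p) \<Rightarrow> ('h \<Rightarrow> 'p) \<Rightarrow> 'a set \<Rightarrow> 'h set \<Rightarrow> 'p set" where
  "smash_sub sP \<iota>A \<iota>H B C = module.span sP {\<iota>A b * \<iota>H x | b x. b \<in> B \<and> x \<in> C}"

text \<open>
  The algebra homomorphism \<open>X \<mapsto> smash_hat X\<close> from \<open>A # H\<close> to the linear endomorphisms of \<open>A\<close> that sends
  \<open>a \<in> A\<close> to left multiplication by \<open>a\<close> and \<open>x \<in> H\<close> to its action.
\<close>

definition smash_hat ::
  "('k::field \<Rightarrow> 'a::ring_1 \<Rightarrow> 'a) \<Rightarrow> ('h \<Rightarrow> 'a \<Rightarrow> 'a) \<Rightarrow>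
   ('k \<Rightarrow> 'p::ring_1 \<Rightarrow> 'p) \<Rightarrow> ('a \<Rightarrow> 'p) \<Rightarrow> ('h \<Rightarrow> 'p) \<Rightarrow> 'p \<Rightarrow> 'a \<Rightarrow> 'a" where
  "smash_hat sA act sP \<iota>A \<iota>H = (THE \<phi>.
     (\<forall>X. Vector_Spaces.linear sA sA (\<phi> X)) \<and>
     (\<forall>a. Vector_Spaces.linear sP sA (\<lambda>X. \<phi> X a)) \<and>
     \<phi> 1 = id \<and> (\<forall>X Y. \<phi> (X * Y) = \<phi> X \<circ> \<phi> Y) \<and>
     (\<forall>a b. \<phi> (\<iota>A a) b = a * b) \<and> (\<forall>x b. \<phi> (\<iota>H x) b = act x b))"

definition noetherian_scalars :: "'l::comm_ring_1 itself \<Rightarrow> bool" where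
  "noetherian_scalars _ \<longleftrightarrow>
     (\<forall>I. module.subspace ((*) :: 'l \<Rightarrow> 'l \<Rightarrow> 'l) I \<longrightarrow>
          (\<exists>G. finite G \<and> module.span (*) G = I))"

definition fract_scale ::
  "('k::field \<Rightarrow> 'l::idom \<Rightarrow> 'l) \<Rightarrow> 'k \<Rightarrow> 'l fract \<Rightarrow> 'l fract" where
  "fract_scale s c f = to_fract (s c 1) * f"

text \<open>
  The Hopf algebra is \<open>'h\<close>, with left coideal subalgebra \<open>H\<close>; the domain is \<open>'l\<close>, with field of
  fractions \<open>'l fract\<close>; and \<open>'p\<close> is the smash product of \<open>'l fract\<close> and \<open>'h\<close>.
\<close>

locale hopf_galois_order_setting =
  \<Lambda>: module_algebra sH \<Delta> \<epsilon> S s\<Lambda> act +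
  smash_product sH \<Delta> \<epsilon> S "fract_scale s\<Lambda>" actL sP \<iota>L \<iota>H
  for sH :: "'k::field \<Rightarrow> 'h::ring_1 \<Rightarrow> 'h" and \<Delta> \<epsilon> S
    and s\<Lambda> :: "'k \<Rightarrow> 'l::idom \<Rightarrow> 'l" and act actL
    and sP :: "'k \<Rightarrow> 'p::ring_1 \<Rightarrow> 'p" and \<iota>L \<iota>H +
  fixes H :: "'h set"
  assumes antipode_bij: "bij S"
    and coideal: "left_coideal_subalgebra sH \<Delta> H"
    and noetherian: "noetherian_scalars TYPE('l)"
    and act_extends: "actL x (to_fract a) = to_fract (act x a)"
    and faithful: "X \<in> smash_sub sP \<iota>L \<iota>H (range to_fract) H \<Longrightarrow>
      (\<And>a. smash_hat (fract_scale s\<Lambda>) actL sP \<iota>L \<iota>H X (to_fract a) = 0) \<Longrightarrow> X = 0"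

locale galois_order = hopf_galois_order_setting sH \<Delta> \<epsilon> S s\<Lambda> act actL sP \<iota>L \<iota>H H
  for sH :: "'k::field \<Rightarrow> 'h::ring_1 \<Rightarrow> 'h" and \<Delta> \<epsilon> S
    and s\<Lambda> :: "'k \<Rightarrow> 'l::idom \<Rightarrow> 'l" and act actL
    and sP :: "'k \<Rightarrow> 'p::ring_1 \<Rightarrow> 'p" and \<iota>L \<iota>H H +
  fixes F :: "'p set"
  assumes order_subset: "F \<subseteq> smash_sub sP \<iota>L \<iota>H UNIV H"
    and order_subalgebra: "subalgebra sP F"
    and order_contains: "\<iota>L (to_fract a) \<in> F"
    and order_full: "module.span sP {\<iota>L f * X | f X. X \<in> F} = smash_sub sP \<iota>L \<iota>H UNIV H"
    and order_preserves: "X \<in> F \<Longrightarrow>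
      smash_hat (fract_scale s\<Lambda>) actL sP \<iota>L \<iota>H X (to_fract a) \<in> range to_fract"

definition order_minus ::
  "('k::field \<Rightarrow> 'l::idom \<Rightarrow> 'l) \<Rightarrow> ('h \<Rightarrow> 'l fract \<Rightarrow> 'l fract) \<Rightarrow>
   ('k \<Rightarrow> 'p::ring_1 \<Rightarrow> 'p) \<Rightarrow> ('l fract \<Rightarrow> 'p) \<Rightarrow> ('h \<Rightarrow> 'p) \<Rightarrow> 'p set \<Rightarrow> 'p set" where
  "order_minus s\<Lambda> actL sP \<iota>L \<iota>H F =
     {X \<in> F. smash_hat (fract_scale s\<Lambda>) actL sP \<iota>L \<iota>H X (to_fract 1) = 0}"

definition left_scalar_mult :: "('l::idom fract \<Rightarrow> 'p::ring_1) \<Rightarrow> 'l \<Rightarrow> 'p \<Rightarrow> 'p" where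
  "left_scalar_mult \<iota>L a X = \<iota>L (to_fract a) * X"

definition internal_direct_sum ::
  "('r::comm_ring_1 \<Rightarrow> 'm \<Rightarrow> 'm::ab_group_add) \<Rightarrow> 'm set \<Rightarrow> 'm set \<Rightarrow> 'm set \<Rightarrow> bool" where
  "internal_direct_sum s M A B \<longleftrightarrow>
     module.subspace s A \<and> module.subspace s B \<and>
     A \<inter> B = {0} \<and> M = {a + b | a b. a \<in> A \<and> b \<in> B}"

end

theory Submission
  imports Defs
begin

text \<open>
  The map \<open>\<phi>(a x) b = a (x \<triangleright> b)\<close> is a well-defined algebra homomorphism from the smash product to
  the linear endomorphisms of \<open>A\<close>, so evaluation \<open>X \<mapsto> \<phi>(X) 1\<close> is left \<open>A\<close>-linear and splits the
  inclusion of \<open>A\<close>. On the order \<open>F\<close> it takes values in \<open>\<Lambda>\<close>, hence its kernel in \<open>F\<close> is a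
  complement of \<open>\<Lambda>\<close>.
\<close>

section \<open>Formal linear combinations and their linear extensions\<close>

lemma lookup_free_scale [simp]:
  "Poly_Mapping.lookup (free_scale c t) i = c * Poly_Mapping.lookup t i"
  by (simp add: free_scale_def map.rep_eq when_def)

lemma vector_space_free_scale: "vector_space (free_scale :: 'k::field \<Rightarrow> ('i \<Rightarrow>\<^sub>0 'k) \<Rightarrow> _)"
  by unfold_locales (auto intro!: poly_mapping_eqI simp: lookup_add algebra_simps)

context vector_space
begin

text \<open>Coefficients vanish off the support, so enlarging the index set adds only zeros. This
  allows combinations with different supports to be compared termwise over a common finite
  set.\<close>

lemma lin_ext_superset:
  assumes "finite K" "Poly_Mapping.keys t \<subseteq> K"
  shows "lin_ext scale f t = (\<Sum>i\<in>K. scale (Poly_Mapping.lookup t i) (f i))"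
  unfolding lin_ext_def using assms
  by (intro sum.mono_neutral_left) (auto simp: in_keys_iff)

lemma lin_ext_add: "lin_ext scale f (t + u) = lin_ext scale f t + lin_ext scale f u"
proof -
  let ?K = "Poly_Mapping.keys t \<union> Poly_Mapping.keys u"
  have "Poly_Mapping.keys (t + u) \<subseteq> ?K"
    by (rule Poly_Mapping.keys_add)
  then show ?thesis
    by (simp add: lin_ext_superset[of ?K] lookup_add scale_left_distrib sum.distrib)
qed

lemma lin_ext_free_scale: "lin_ext scale f (free_scale c t) = scale c (lin_ext scale f t)"
proof -
  have "Poly_Mapping.keys (free_scale c t) \<subseteq> Poly_Mapping.keys t"
    by (auto simp: in_keys_iff)
  then show ?thesis
    by (simp add: lin_ext_superset[of "Poly_Mapping.keys t"] scale_sum_right)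
qed

lemma linear_lin_ext: "Vector_Spaces.linear free_scale scale (lin_ext scale f)"
  by (intro Vector_Spaces.linear_iff[THEN iffD2] conjI allI vector_space_free_scale vector_space_axioms
      lin_ext_add lin_ext_free_scale)

lemma lin_ext_single [simp]: "lin_ext scale f (Poly_Mapping.single i c) = scale c (f i)"
  by (simp add: lin_ext_def)

end

lemma linear_comp_lin_ext:
  assumes "Vector_Spaces.linear s s' g"
  shows "g (lin_ext s f t) = lin_ext s' (\<lambda>i. g (f i)) t"
proof -
  interpret Vector_Spaces.linear s s' g by fact
  show ?thesis by (simp add: lin_ext_def sum scale)
qed

text \<open>The two kinds of relation are sent to the defects of additivity and homogeneity of
  \<open>f\<close> in the chosen slot, and these vanish.\<close>

lemma lin_ext_slot_relations:
  assumes "Vector_Spaces.linear sV s (\<lambda>v. f (p v))" "r \<in> slot_relations sV p"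
  shows "lin_ext s f r = 0"
proof -
  interpret Vector_Spaces.linear sV s "\<lambda>v. f (p v)" by fact
  interpret E: Vector_Spaces.linear free_scale s "lin_ext s f"
    by (rule vs2.linear_lin_ext)
  show ?thesis
    using assms(2) by (auto simp: slot_relations_def E.diff add scale)
qed

text \<open>Universal property of the tensor product: a bilinear \<open>f\<close> kills every
  relation, hence their span, and so depends only on the class of a representative.\<close>

lemma lin_ext_tensor_cong:
  assumes "\<And>w. Vector_Spaces.linear sV s (\<lambda>v. f (v, w))"
    and "\<And>v. Vector_Spaces.linear sW s (\<lambda>w. f (v, w))"
    and "(t, u) \<in> tensor_eq sV sW"
  shows "lin_ext s f t = lin_ext s f u"
proof -
  \<comment> \<open>The second entry is arbitrary; the interpretation supplies the vector space
    structure of the target.\<close>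
  interpret Vector_Spaces.linear sV s "\<lambda>v. f (v, undefined)" by fact
  interpret E: Vector_Spaces.linear free_scale s "lin_ext s f"
    by (rule vs2.linear_lin_ext)
  have "lin_ext s f (t - u) = 0"
    by (rule E.eq_0_on_span[OF _ assms(3)[unfolded tensor_eq_def mem_Collect_eq prod.case]])
      (auto intro: lin_ext_slot_relations[where f = f and p = "\<lambda>v. (v, _)", OF assms(1)]
        lin_ext_slot_relations[where f = f and p = "\<lambda>w. (_, w)", OF assms(2)])
  then show ?thesis by (simp add: E.diff)
qed

lemma tensor_eq_refl: "(t, t) \<in> tensor_eq sV sW"
proof -
  interpret vector_space free_scale
    by (rule vector_space_free_scale)
  show ?thesis by (simp add: tensor_eq_def span_zero)
qed

context hopf_algebra
begin

text \<open>An equivalence class contains its own representative, so there is always a Sweedler sum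
  to compute with.\<close>

lemma comult_nonempty: obtains t where "t \<in> \<Delta> x"
  using comult_in_tensor[of x] tensor_eq_refl by (fastforce elim!: quotientE)

end

context k_algebra
begin

lemma linear_mult_left: "Vector_Spaces.linear scale scale (\<lambda>b. a * b)"
  by (auto intro!: Vector_Spaces.linear_iff[THEN iffD2] vector_space_axioms simp: distrib_left scale_mult_right)

lemma linear_mult_right: "Vector_Spaces.linear scale scale (\<lambda>a. a * b)"
  by (auto intro!: Vector_Spaces.linear_iff[THEN iffD2] vector_space_axioms simp: distrib_right scale_mult_left)

end

section \<open>The action of the smash product on the algebra\<close>

context smash_product
begin

abbreviation smash_sum :: "('a \<times> 'h \<Rightarrow>\<^sub>0 'k) \<Rightarrow> 'p" where
  "smash_sum \<equiv> lin_ext sP (\<lambda>(a, x). \<iota>A a * \<iota>H x)"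

abbreviation smash_eval :: "'a \<Rightarrow> ('a \<times> 'h \<Rightarrow>\<^sub>0 'k) \<Rightarrow> 'a" where
  "smash_eval b \<equiv> lin_ext sA (\<lambda>(a, x). a * act x b)"

definition smash_act :: "'p \<Rightarrow> 'a \<Rightarrow> 'a" where
  "smash_act X b = smash_eval b (SOME T. smash_sum T = X)"

lemma smash_sum_cases: obtains T where "X = smash_sum T"
  using smash_surj by (metis surjD)

text \<open>Independence of the chosen representative: by \<open>smash_kernel\<close> two choices
  differ by tensor relations, and \<open>a * act x b\<close> is bilinear in \<open>a\<close> and
  \<open>x\<close>.\<close>

lemma smash_act_sum: "smash_act (smash_sum T) b = smash_eval b T"
  unfolding smash_act_def
proof (rule lin_ext_tensor_cong)
  show "((SOME U. smash_sum U = smash_sum T), T) \<in> tensor_eq sA sH"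
    by (subst smash_kernel[symmetric]) (rule someI, rule refl)
  show "Vector_Spaces.linear sA sA (\<lambda>v. case (v, w) of (a, x) \<Rightarrow> a * act x b)" for w
    by (simp add: A.linear_mult_right)
  show "Vector_Spaces.linear sH sA (\<lambda>w. case (v, w) of (a, x) \<Rightarrow> a * act x b)" for v
    using Vector_Spaces.linear_compose[OF act_linear_left A.linear_mult_left]
    by (simp add: o_def)
qed

lemma smash_act_gen: "smash_act (\<iota>A a * \<iota>H x) b = a * act x b"
  using smash_act_sum[of "Poly_Mapping.single (a, x) 1" b] by simp

lemma linear_smash_act_left: "Vector_Spaces.linear sP sA (\<lambda>X. smash_act X b)"
proof (intro Vector_Spaces.linear_iff[THEN iffD2] conjI allI P.vector_space_axioms A.vector_space_axioms)
  show "smash_act (X + Y) b = smash_act X b + smash_act Y b" for X Y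
    by (rule smash_sum_cases[of X], rule smash_sum_cases[of Y])
      (simp add: smash_act_sum A.lin_ext_add flip: P.lin_ext_add)
  show "smash_act (sP c X) b = sA c (smash_act X b)" for c X
    by (rule smash_sum_cases[of X])
      (simp add: smash_act_sum A.lin_ext_free_scale flip: P.lin_ext_free_scale)
qed

text \<open>By surjectivity of \<open>smash_sum\<close>, the products of the two subalgebras span
  the smash product.\<close>

lemma linear_eq_on_smash:
  assumes "Vector_Spaces.linear sP s f" "Vector_Spaces.linear sP s g"
    and "\<And>a x. f (\<iota>A a * \<iota>H x) = g (\<iota>A a * \<iota>H x)"
  shows "f X = g X"
proof (rule smash_sum_cases[of X])
  fix T assume "X = smash_sum T"
  then show ?thesis
    by (simp add: linear_comp_lin_ext[OF assms(1)] linear_comp_lin_ext[OF assms(2)]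
        assms(3) case_prod_unfold)
qed

lemma linear_smash_act: "Vector_Spaces.linear sA sA (smash_act X)"
proof -
  obtain T where X: "X = smash_sum T" by (rule smash_sum_cases)
  have lin: "Vector_Spaces.linear sA sA (\<lambda>b. a * act x b)" for a x
    using Vector_Spaces.linear_compose[OF act_linear A.linear_mult_left] by (simp add: o_def)
  show ?thesis
    \<comment> \<open>With one representative fixed for all arguments, the map is a finite sum of
      linear maps.\<close>
    unfolding X smash_act_sum
    using lin
    by (auto simp: Vector_Spaces.linear_iff A.lin_ext_superset[OF finite_keys order_refl] case_prod_unfold
        A.scale_right_distrib A.scale_sum_right A.scale_left_commute sum.distrib mult.commute)
qed

lemma incl_A_mult: "\<iota>A (a * b) = \<iota>A a * \<iota>A b"
  and incl_A_one: "\<iota>A 1 = 1"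
  using incl_A(1) by (simp_all add: algebra_hom_def)

lemma incl_H_mult: "\<iota>H (x * y) = \<iota>H x * \<iota>H y"
  and incl_H_one: "\<iota>H 1 = 1"
  using incl_H(1) by (simp_all add: algebra_hom_def)

text \<open>Moving \<open>x\<close> past \<open>b\<close> by the smash commutation rule produces the
  same Sweedler sum as letting \<open>x\<close> act on the product of \<open>b\<close> and
  \<open>act y c\<close>.\<close>

lemma smash_act_mult_gen:
  "smash_act (\<iota>A a * \<iota>H x * (\<iota>A b * \<iota>H y)) c = a * act x (b * act y c)"
proof -
  obtain t where t: "t \<in> \<Delta> x" by (rule comult_nonempty)
  have "\<iota>A a * \<iota>H x * (\<iota>A b * \<iota>H y) = \<iota>A a * (\<iota>H x * \<iota>A b) * \<iota>H y"
    by (simp add: mult.assoc)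
  also have "\<dots> = lin_ext sP (\<lambda>(x1, x2). \<iota>A (a * act x1 b) * \<iota>H (x2 * y)) t"
    by (simp add: smash_commute[OF t] linear_comp_lin_ext[OF P.linear_mult_left]
        linear_comp_lin_ext[OF P.linear_mult_right] case_prod_unfold mult.assoc
        incl_A_mult incl_H_mult)
  finally show ?thesis
    by (simp add: linear_comp_lin_ext[OF A.linear_mult_left]
        linear_comp_lin_ext[OF linear_smash_act_left] smash_act_gen case_prod_unfold
        act_prod[OF t] act_mult mult.assoc)
qed

text \<open>Both sides are linear in \<open>X\<close> and in \<open>Y\<close>, so each variable in
  turn reduces to generators.\<close>

lemma smash_act_mult: "smash_act (X * Y) c = smash_act X (smash_act Y c)"
proof (rule linear_eq_on_smash[where X = X])
  show "Vector_Spaces.linear sP sA (\<lambda>X. smash_act (X * Y) c)"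
    using Vector_Spaces.linear_compose[OF P.linear_mult_right linear_smash_act_left] by (simp add: o_def)
  show "Vector_Spaces.linear sP sA (\<lambda>X. smash_act X (smash_act Y c))"
    by (rule linear_smash_act_left)
  fix a x
  show "smash_act (\<iota>A a * \<iota>H x * Y) c = smash_act (\<iota>A a * \<iota>H x) (smash_act Y c)"
  proof (rule linear_eq_on_smash[where X = Y])
    show "Vector_Spaces.linear sP sA (\<lambda>Y. smash_act (\<iota>A a * \<iota>H x * Y) c)"
      using Vector_Spaces.linear_compose[OF P.linear_mult_left linear_smash_act_left] by (simp add: o_def)
    show "Vector_Spaces.linear sP sA (\<lambda>Y. smash_act (\<iota>A a * \<iota>H x) (smash_act Y c))"
      using Vector_Spaces.linear_compose[OF linear_smash_act_left linear_smash_act] by (simp add: o_def)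
  qed (simp only: smash_act_mult_gen smash_act_gen)
qed

lemma smash_act_incl_A: "smash_act (\<iota>A a) b = a * b"
  using smash_act_gen[of a 1 b] by (simp add: incl_H_one act_one)

lemma smash_hat_eq: "smash_hat sA act sP \<iota>A \<iota>H = smash_act"
  unfolding smash_hat_def
proof (rule the_equality, intro conjI allI)
  show "smash_act 1 = id"
    using smash_act_incl_A[of 1] by (simp add: incl_A_one fun_eq_iff)
  show "smash_act (\<iota>H x) b = act x b" for x b
    using smash_act_gen[of 1 x b] by (simp add: incl_A_one)
next
  fix \<phi> :: "'p \<Rightarrow> 'a \<Rightarrow> 'a"
  assume *: "(\<forall>X. Vector_Spaces.linear sA sA (\<phi> X)) \<and>
     (\<forall>a. Vector_Spaces.linear sP sA (\<lambda>X. \<phi> X a)) \<and>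
     \<phi> 1 = id \<and> (\<forall>X Y. \<phi> (X * Y) = \<phi> X \<circ> \<phi> Y) \<and>
     (\<forall>a b. \<phi> (\<iota>A a) b = a * b) \<and> (\<forall>x b. \<phi> (\<iota>H x) b = act x b)"
  have "\<phi> X b = smash_act X b" for X b
    \<comment> \<open>Uniqueness: multiplicativity and the prescribed values on both subalgebras
      determine \<open>\<phi>\<close> on generators.\<close>
    by (rule linear_eq_on_smash[OF _ linear_smash_act_left]) (use * in \<open>simp_all add: smash_act_gen\<close>)
  then show "\<phi> = smash_act" by (simp add: fun_eq_iff)
qed (simp_all add: linear_smash_act linear_smash_act_left smash_act_mult smash_act_incl_A fun_eq_iff)

end

section \<open>Splitting the order by evaluation at one\<close>

context galois_order
begin

lemma incl_L_add: "\<iota>L (f + g) = \<iota>L f + \<iota>L g"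
  using incl_A(1) by (simp add: algebra_hom_def Vector_Spaces.linear_iff)

lemma module_left_scalar_mult: "module (left_scalar_mult \<iota>L)"
  by unfold_locales
    (simp_all add: left_scalar_mult_def distrib_left distrib_right incl_L_add incl_A_mult
      incl_A_one mult.assoc)

lemma smash_act_add: "smash_act (X + Y) b = smash_act X b + smash_act Y b"
  and smash_act_zero: "smash_act 0 b = 0"
  and smash_act_diff: "smash_act (X - Y) b = smash_act X b - smash_act Y b"
proof -
  interpret E: Vector_Spaces.linear sP "fract_scale s\<Lambda>" "\<lambda>X. smash_act X b"
    by (rule linear_smash_act_left)
  show "smash_act (X + Y) b = smash_act X b + smash_act Y b" "smash_act 0 b = 0"
    "smash_act (X - Y) b = smash_act X b - smash_act Y b"
    by (fact E.add E.zero E.diff)+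
qed

lemma order_closed:
  "0 \<in> F" "X \<in> F \<Longrightarrow> Y \<in> F \<Longrightarrow> X + Y \<in> F" "X \<in> F \<Longrightarrow> Y \<in> F \<Longrightarrow> X - Y \<in> F"
  "X \<in> F \<Longrightarrow> Y \<in> F \<Longrightarrow> X * Y \<in> F"
  using order_subalgebra
  by (auto simp: subalgebra_def P.subspace_0 P.subspace_add P.subspace_diff)

lemma order_minus_eq: "order_minus s\<Lambda> actL sP \<iota>L \<iota>H F = {X \<in> F. smash_act X 1 = 0}"
  by (simp add: order_minus_def smash_hat_eq)

text \<open>Evaluation at 1 is left linear over the domain: multiplying \<open>X\<close> on the left
  by a scalar multiplies its value at 1 by that scalar, so the kernel is stable.\<close>

lemma subspace_order_minus:
  "module.subspace (left_scalar_mult \<iota>L) (order_minus s\<Lambda> actL sP \<iota>L \<iota>H F)"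
  by (auto simp: module.subspace_def[OF module_left_scalar_mult] order_minus_eq left_scalar_mult_def
      order_closed order_contains smash_act_zero smash_act_add smash_act_mult smash_act_incl_A)

lemma subspace_base:
  "module.subspace (left_scalar_mult \<iota>L) (range (\<lambda>a. \<iota>L (to_fract a)))"
proof -
  \<comment> \<open>Additivity at \<open>0 + 0\<close> forces the value 0.\<close>
  have "\<iota>L (to_fract 0) = 0"
    using incl_L_add[of 0 0] by simp
  then have "0 \<in> range (\<lambda>a. \<iota>L (to_fract a))"
    by (metis rangeI)
  then show ?thesis
    by (auto simp: module.subspace_def[OF module_left_scalar_mult] left_scalar_mult_def
        simp flip: incl_L_add incl_A_mult to_fract_add to_fract_mult)
qed

text \<open>Evaluation at 1 followed by \<open>\<iota>L\<close> is a projection of \<open>F\<close>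
  onto the copy of the domain, with kernel \<open>order_minus\<close>.\<close>

lemma order_decomposition:
  "internal_direct_sum (left_scalar_mult \<iota>L) F
    (range (\<lambda>a. \<iota>L (to_fract a))) (order_minus s\<Lambda> actL sP \<iota>L \<iota>H F)"
  unfolding internal_direct_sum_def
proof (intro conjI subspace_base subspace_order_minus)
  let ?M = "order_minus s\<Lambda> actL sP \<iota>L \<iota>H F" and ?B = "range (\<lambda>a. \<iota>L (to_fract a))"
  show "?B \<inter> ?M = {0}"
  proof (intro equalityI subsetI)
    fix X assume "X \<in> ?B \<inter> ?M"
    then obtain a where "X = \<iota>L (to_fract a)" "smash_act X 1 = 0"
      by (auto simp: order_minus_eq)
    \<comment> \<open>Evaluating an element of the base at 1 returns \<open>to_fract a\<close>,
      which is therefore 0.\<close>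
    then show "X \<in> {0}"
      using incl_L_add[of 0 0] by (simp add: smash_act_incl_A)
  next
    fix X :: 'p assume "X \<in> {0}"
    then show "X \<in> ?B \<inter> ?M"
      using module.subspace_0[OF module_left_scalar_mult] subspace_base subspace_order_minus
      by blast
  qed
  show "F = {X + Y | X Y. X \<in> ?B \<and> Y \<in> ?M}"
  proof (intro equalityI subsetI)
    fix X assume X: "X \<in> F"
    \<comment> \<open>The component in the domain is the value of \<open>X\<close> at 1, which lies
      in the domain because \<open>F\<close> preserves it.\<close>
    obtain a where a: "smash_act X 1 = to_fract a"
      using order_preserves[OF X, of 1] by (auto simp: smash_hat_eq)
    have "X - \<iota>L (to_fract a) \<in> ?M"
      by (simp add: order_minus_eq order_closed X order_contains smash_act_diff a smash_act_incl_A)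
    moreover have "X = \<iota>L (to_fract a) + (X - \<iota>L (to_fract a))" by simp
    ultimately show "X \<in> {X + Y | X Y. X \<in> ?B \<and> Y \<in> ?M}" by blast
  qed (auto simp: order_minus_eq order_closed order_contains)
qed

end

theorem lemma3p11:
  fixes sH :: "'k::field \<Rightarrow> 'h::ring_1 \<Rightarrow> 'h"
    and \<Delta> :: "'h \<Rightarrow> (('h \<times> 'h) \<Rightarrow>\<^sub>0 'k) set"
    and \<epsilon> :: "'h \<Rightarrow> 'k"
    and S :: "'h \<Rightarrow> 'h"
    and s\<Lambda> :: "'k \<Rightarrow> 'l::idom \<Rightarrow> 'l"
    and act :: "'h \<Rightarrow> 'l \<Rightarrow> 'l"
    and actL :: "'h \<Rightarrow> 'l fract \<Rightarrow> 'l fract"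
    and sP :: "'k \<Rightarrow> 'p::ring_1 \<Rightarrow> 'p"
    and \<iota>L :: "'l fract \<Rightarrow> 'p"
    and \<iota>H :: "'h \<Rightarrow> 'p"
    and H :: "'h set"
    and F :: "'p set"
  assumes "hopf_galois_order_setting sH \<Delta> \<epsilon> S s\<Lambda> act actL sP \<iota>L \<iota>H H"
    and "galois_order sH \<Delta> \<epsilon> S s\<Lambda> act actL sP \<iota>L \<iota>H H F"
  shows "order_minus s\<Lambda> actL sP \<iota>L \<iota>H F \<subseteq> F \<and>
    module.subspace (left_scalar_mult \<iota>L) (order_minus s\<Lambda> actL sP \<iota>L \<iota>H F) \<and>
    internal_direct_sum (left_scalar_mult \<iota>L) F
      (range (\<lambda>a. \<iota>L (to_fract a))) (order_minus s\<Lambda> actL sP \<iota>L \<iota>H F)"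
proof -
  interpret galois_order sH \<Delta> \<epsilon> S s\<Lambda> act actL sP \<iota>L \<iota>H H F by fact
  show ?thesis
    by (intro conjI subspace_order_minus order_decomposition) (auto simp: order_minus_eq)
qed

end
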